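(* Let $G$ be a connected $(v,k,\lambda,\mu)$-SRG. If $$4(k-2\lambda)(k-\mu)>(\lambda-\mu)^2(2k-\lambda-3),$$ then $G$ is OK.
   Context: All graphs are finite and simple. A graph $G$ is a $(v,k,\lambda,\mu)$-SRG (strongly regular graph) if it has $v$ vertices, is $k$-regular, any two adjacent vertices have exactly $\lambda$ common neighbors, and any two distinct non-adjacent vertices have exactly $\mu$ common neighbors. A disconnecting set of a connected graph $G$ is a set $S$ of vertices such that $G\setminus S$ is disconnected. If $G$ has a disconnecting set $S$ such that every component of $G\setminus S$ has at least two vertices, then $\kappa_2(G)$ denotes the minimum size of such a set. A connected $(v,k,\lambda,\mu)$-SRG $G$ is called OK if either it has no disconnecting set $S$ such that each component of $G\setminus S$ has at least two vertices, or $\kappa_2(G)=2k-\lambda-2$. *)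

theory Defs
  imports Complex_Main "Graph_Theory.Digraph_Component"
begin

text \<open>Finite simple graphs are the symmetric digraphs without loops and parallel arcs of the
  locale \<^locale>\<open>graph\<close>; an edge is a pair of opposite arcs, so the degree of a vertex is its
  out-degree, and the components are the strongly connected components.\<close>

definition common_neighbors :: "('a, 'b) pre_digraph \<Rightarrow> 'a \<Rightarrow> 'a \<Rightarrow> 'a set" where
  "common_neighbors G x y = {z \<in> verts G. x \<rightarrow>\<^bsub>G\<^esub> z \<and> y \<rightarrow>\<^bsub>G\<^esub> z}"

definition strongly_regular ::
  "('a, 'b) pre_digraph \<Rightarrow> nat \<Rightarrow> nat \<Rightarrow> nat \<Rightarrow> nat \<Rightarrow> bool" where
  "strongly_regular G v k lam mu \<longleftrightarrow>
     graph G \<and> card (verts G) = v \<and>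
     (\<forall>x \<in> verts G. out_degree G x = k) \<and>
     (\<forall>x \<in> verts G. \<forall>y \<in> verts G. x \<rightarrow>\<^bsub>G\<^esub> y \<longrightarrow> card (common_neighbors G x y) = lam) \<and>
     (\<forall>x \<in> verts G. \<forall>y \<in> verts G. x \<noteq> y \<and> \<not> x \<rightarrow>\<^bsub>G\<^esub> y \<longrightarrow>
        card (common_neighbors G x y) = mu)"

definition del_verts :: "('a, 'b) pre_digraph \<Rightarrow> 'a set \<Rightarrow> ('a, 'b) pre_digraph" where
  "del_verts G S = induce_subgraph G (verts G - S)"

text \<open>The null graph does not satisfy \<^const>\<open>connected\<close>, but it is not disconnected either,
  so deleting all vertices must be excluded explicitly.\<close>

definition disconnecting_set :: "('a, 'b) pre_digraph \<Rightarrow> 'a set \<Rightarrow> bool" where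
  "disconnecting_set G S \<longleftrightarrow>
     S \<subseteq> verts G \<and> verts (del_verts G S) \<noteq> {} \<and> \<not> connected (del_verts G S)"

definition nontrivially_disconnecting_set :: "('a, 'b) pre_digraph \<Rightarrow> 'a set \<Rightarrow> bool" where
  "nontrivially_disconnecting_set G S \<longleftrightarrow>
     disconnecting_set G S \<and>
     (\<forall>C \<in> pre_digraph.sccs (del_verts G S). 2 \<le> card (verts C))"

text \<open>Meaningful only if \<open>G\<close> has such a disconnecting set.\<close>

definition kappa2 :: "('a, 'b) pre_digraph \<Rightarrow> nat" where
  "kappa2 G = (LEAST n. \<exists>S. nontrivially_disconnecting_set G S \<and> card S = n)"

text \<open>The parameters \<open>k\<close> and \<open>lam\<close> are those of the strongly regular graph \<open>G\<close>.\<close>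

definition OK :: "('a, 'b) pre_digraph \<Rightarrow> nat \<Rightarrow> nat \<Rightarrow> bool" where
  "OK G k lam \<longleftrightarrow>
     (\<nexists>S. nontrivially_disconnecting_set G S) \<or>
     int (kappa2 G) = 2 * int k - int lam - 2"

end

(* Let a set A be separated from B by S, with no edge between A and B.  The function
   F = 2 d_A - (lam - mu) 1_A, where d_A counts neighbours in A, vanishes on B, and the sum of its
   values and of their squares over the whole graph are determined by the parameters; Cauchy-Schwarz
   on the complement of B gives 4 mu |A| |B| <= ((lam - mu)^2 + 4 (k - mu)) |S|.  If both sides contain
   an edge, either one side has two vertices and S contains the neighbourhood of an edge, or both
   have at least three and the hypothesis yields |S| >= 2k - lam - 2.

   Conversely, the neighbourhood of an edge xy has size 2k - lam - 2 and works unless it isolates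
   some vertex z.  If every edge failed in this way, the hypothesis would force k = 2 mu and
   mu - lam in {1, 2}; counting the nonadjacent pairs (x, z) then gives lam = 0, which leaves only the
   pentagon, and that has no nontrivially disconnecting set. *)

theory Submission
  imports Defs
begin

section \<open>Counting in a strongly regular graph and the separation bound\<close>

locale srg =
  fixes V :: "'a set" and adj :: "'a \<Rightarrow> 'a \<Rightarrow> bool" and k l m :: nat
  fixes N :: "'a \<Rightarrow> 'a set"
  defines "N x \<equiv> {y \<in> V. adj x y}"
  assumes finite_V: "finite V"
    and adj_in_V: "adj x y \<Longrightarrow> x \<in> V"
    and adj_sym: "adj x y \<Longrightarrow> adj y x"
    and adj_irrefl: "\<not> adj x x"
    and card_N: "x \<in> V \<Longrightarrow> card (N x) = k"
    and card_common_adj: "adj x y \<Longrightarrow> card (N x \<inter> N y) = l"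
    and card_common_nonadj:
      "\<lbrakk>x \<in> V; y \<in> V; x \<noteq> y; \<not> adj x y\<rbrakk> \<Longrightarrow> card (N x \<inter> N y) = m"
begin

lemma mem_N_iff: "y \<in> N x \<longleftrightarrow> adj x y"
  using adj_in_V adj_sym by (auto simp: N_def)

lemma N_subset: "N x \<subseteq> V"
  by (auto simp: N_def)

lemma finite_N [simp]: "finite (N x)"
  using finite_V by (simp add: N_def)

lemma adj_commute: "adj x y \<longleftrightarrow> adj y x"
  using adj_sym by blast

lemma sum_adj_eq_card:
  assumes "A \<subseteq> V"
  shows "(\<Sum>y\<in>A. of_bool (adj x y)) = int (card (N x \<inter> A))"
proof -
  have "finite A" using assms finite_V by (rule finite_subset)
  moreover have "A \<inter> {y. adj x y} = N x \<inter> A" using assms by (auto simp: N_def)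
  ultimately show ?thesis by (simp add: sum_of_bool_eq)
qed

text \<open>Entrywise form of A^2 = m J + (l - m) A + (k - m) I for the adjacency matrix A, over the
  integers because l - m may be negative.\<close>

lemma card_common:
  assumes "x \<in> V" "y \<in> V"
  shows "int (card (N x \<inter> N y))
    = int m + (int l - int m) * of_bool (adj x y) + (int k - int m) * of_bool (x = y)"
  using assms card_N card_common_adj card_common_nonadj adj_irrefl by auto

lemma sum_common:
  assumes "x \<in> V" "y \<in> V"
  shows "(\<Sum>z\<in>V. of_bool (adj z x) * of_bool (adj z y))
    = int m + (int l - int m) * of_bool (adj x y) + (int k - int m) * of_bool (x = y)"
proof -
  have "V \<inter> {z. adj z x \<and> adj z y} = N x \<inter> N y" by (auto simp: N_def adj_commute)
  moreover have "(\<Sum>z\<in>V. of_bool (adj z x) * of_bool (adj z y))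
      = (\<Sum>z\<in>V. (of_bool (adj z x \<and> adj z y) :: int))"
    by (simp add: of_bool_conj)
  ultimately show ?thesis using finite_V assms by (simp add: sum_of_bool_eq card_common)
qed

text \<open>Walks of length two from \<open>x\<close> are counted once by end vertex, via
  \<open>sum_common\<close>, and once by middle vertex.\<close>

lemma parameter_equation:
  assumes "x \<in> V"
  shows "int m * (int (card V) - 1 - int k) = int k * (int k - int l - 1)"
proof -
  have "(\<Sum>y\<in>V. \<Sum>z\<in>V. (of_bool (adj z x) * of_bool (adj z y) :: int))
      = (\<Sum>z\<in>V. of_bool (adj z x) * (\<Sum>y\<in>V. of_bool (adj z y)))"
    by (subst sum.swap) (simp add: sum_distrib_left)
  also have "\<dots> = (\<Sum>z\<in>V. of_bool (adj z x) * int k)"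
    by (intro sum.cong refl) (simp add: sum_adj_eq_card card_N N_subset Int_absorb2)
  also have "\<dots> = int k * int k"
    using assms by (simp flip: sum_distrib_right
        add: sum_adj_eq_card card_N N_subset Int_absorb2 adj_commute[of _ x])
  also have "(\<Sum>y\<in>V. \<Sum>z\<in>V. (of_bool (adj z x) * of_bool (adj z y) :: int))
      = int m * int (card V) + (int l - int m) * int k + (int k - int m)"
  proof -
    have "(\<Sum>y\<in>V. (of_bool (x = y) :: int)) = 1"
      using assms finite_V by (simp add: sum_of_bool_eq)
    then show ?thesis using assms
      by (simp add: sum_common sum.distrib sum_adj_eq_card card_N N_subset Int_absorb2
          flip: sum_distrib_left)
  qed
  finally show ?thesis by (simp add: algebra_simps)
qed

lemma separation_bound:
  assumes A: "A \<subseteq> V" and B: "B \<subseteq> V" and disj: "A \<inter> B = {}" and ne: "A \<noteq> {}"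
    and sep: "\<And>x y. \<lbrakk>x \<in> A; y \<in> B\<rbrakk> \<Longrightarrow> \<not> adj x y"
  shows "4 * int m * int (card A) * int (card B)
    \<le> ((int l - int m)\<^sup>2 + 4 * (int k - int m)) * int (card (V - A - B))"
proof -
  define d where "d x = (\<Sum>y\<in>A. (of_bool (adj x y) :: int))" for x
  \<comment> \<open>The coefficient l - m makes the sum of \<open>d\<close> over \<open>A\<close>,
    which the parameters do not determine, cancel in the sum of squares of \<open>F\<close>.\<close>
  define F where "F x = 2 * d x - (int l - int m) * of_bool (x \<in> A)" for x
  define a where "a = int (card A)"
  define b where "b = int (card B)"
  define v where "v = int (card V)"
  define n where "n = int (card (V - B))"
  \<comment> \<open>Discriminant of t^2 - (l - m) t - (k - m). Its roots r and s are the restricted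
    eigenvalues, so \<open>D\<close> is (r - s)^2.\<close>
  define D where "D = (int l - int m)\<^sup>2 + 4 * (int k - int m)"
  have finA: "finite A" using A finite_V by (rule finite_subset)
  obtain x0 where x0: "x0 \<in> A" using ne by auto
  have a_pos: "a > 0" using finA ne by (simp add: a_def card_gt_0_iff)
  have VA: "V \<inter> A = A" using A by auto
  have n_eq: "n = v - b"
    using B finite_V by (simp add: n_def v_def b_def card_Diff_subset card_mono finite_subset)
  have n_pos: "n > 0"
  proof -
    have "A \<subseteq> V - B" using A disj by auto
    then have "card A \<le> card (V - B)" using finite_V by (intro card_mono) auto
    then show ?thesis using a_pos by (simp add: a_def n_def)
  qed
  have sum_d: "(\<Sum>x\<in>V. d x) = int k * a"
  proof -
    have "(\<Sum>x\<in>V. d x) = (\<Sum>y\<in>A. \<Sum>x\<in>V. of_bool (adj y x))"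
      unfolding d_def by (subst sum.swap) (simp add: adj_commute)
    also have "\<dots> = (\<Sum>y\<in>A. int k)"
      using A by (intro sum.cong refl) (auto simp: sum_adj_eq_card card_N N_subset Int_absorb2)
    finally show ?thesis by (simp add: a_def)
  qed
  have sum_d_sq: "(\<Sum>x\<in>V. (d x)\<^sup>2)
      = int m * a\<^sup>2 + (int l - int m) * (\<Sum>x\<in>A. d x) + (int k - int m) * a"
  proof -
    have "(\<Sum>x\<in>V. (d x)\<^sup>2)
        = (\<Sum>x\<in>V. \<Sum>y\<in>A. \<Sum>z\<in>A. of_bool (adj x y) * of_bool (adj x z))"
      by (simp add: d_def power2_eq_square sum_product)
    also have "\<dots> = (\<Sum>y\<in>A. \<Sum>x\<in>V. \<Sum>z\<in>A. of_bool (adj x y) * of_bool (adj x z))"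
      by (rule sum.swap)
    also have "\<dots> = (\<Sum>y\<in>A. \<Sum>z\<in>A. \<Sum>x\<in>V. of_bool (adj x y) * of_bool (adj x z))"
      by (intro sum.cong refl sum.swap)
    also have "\<dots> = (\<Sum>y\<in>A. \<Sum>z\<in>A. int m + (int l - int m) * of_bool (adj y z)
        + (int k - int m) * of_bool (y = z))"
      using A by (intro sum.cong refl sum_common) auto
    also have "\<dots> = (\<Sum>y\<in>A. int m * a + (int l - int m) * d y + (int k - int m))"
    proof (intro sum.cong refl)
      fix y assume "y \<in> A"
      then have "(\<Sum>z\<in>A. (of_bool (y = z) :: int)) = 1"
        using finA by (simp add: sum_of_bool_eq)
      then show "(\<Sum>z\<in>A. int m + (int l - int m) * of_bool (adj y z)
            + (int k - int m) * of_bool (y = z))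
          = int m * a + (int l - int m) * d y + (int k - int m)"
        by (simp add: sum.distrib a_def d_def flip: sum_distrib_left)
    qed
    also have "\<dots> = int m * a\<^sup>2 + (int l - int m) * (\<Sum>x\<in>A. d x) + (int k - int m) * a"
      by (simp add: sum.distrib power2_eq_square flip: a_def sum_distrib_left)
    finally show ?thesis .
  qed
  have sum_A: "(\<Sum>x\<in>V. f x * of_bool (x \<in> A)) = (\<Sum>x\<in>A. f x)" for f :: "'a \<Rightarrow> int"
    using finite_V VA by (simp add: of_bool_def if_distrib sum.If_cases cong: if_cong)
  have F_B: "F x = 0" if "x \<in> B" for x
  proof -
    have "d x = 0" using sep that by (auto simp: d_def adj_commute intro!: sum.neutral)
    then show ?thesis using that disj by (auto simp: F_def)
  qed
  have sum_F: "(\<Sum>x\<in>V - B. F x) = (2 * int k - int l + int m) * a"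
  proof -
    have "(\<Sum>x\<in>V - B. F x) = (\<Sum>x\<in>V. F x)"
      using F_B finite_V by (intro sum.mono_neutral_left) auto
    also have "\<dots> = 2 * (int k * a) - (int l - int m) * a"
      using sum_A[of "\<lambda>_. int l - int m"] sum_d
      by (simp add: F_def sum_subtractf a_def flip: sum_distrib_left)
    finally show ?thesis by (simp add: algebra_simps)
  qed
  have sum_F_sq: "(\<Sum>x\<in>V - B. (F x)\<^sup>2) = 4 * int m * a\<^sup>2 + D * a"
  proof -
    have "(\<Sum>x\<in>V - B. (F x)\<^sup>2) = (\<Sum>x\<in>V. (F x)\<^sup>2)"
      using F_B finite_V by (intro sum.mono_neutral_left) auto
    also have "\<dots> = (\<Sum>x\<in>V. 4 * (d x)\<^sup>2
        + ((int l - int m)\<^sup>2 - 4 * (int l - int m) * d x) * of_bool (x \<in> A))"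
      by (intro sum.cong refl) (auto simp: F_def power2_eq_square algebra_simps)
    also have "\<dots> = 4 * (\<Sum>x\<in>V. (d x)\<^sup>2) + ((int l - int m)\<^sup>2 * a
        - 4 * (int l - int m) * (\<Sum>x\<in>A. d x))"
      using sum_A[of "\<lambda>x. (int l - int m)\<^sup>2 - 4 * (int l - int m) * d x"]
      by (simp add: sum.distrib sum_subtractf a_def flip: sum_distrib_left)
    also have "\<dots> = 4 * int m * a\<^sup>2 + D * a"
      unfolding sum_d_sq D_def by (simp add: algebra_simps)
    finally show ?thesis .
  qed
  define T where "T = (\<Sum>x\<in>V - B. F x)"
  define Q where "Q = (\<Sum>x\<in>V - B. (F x)\<^sup>2)"
  \<comment> \<open>Cauchy-Schwarz for \<open>F\<close> and the constant 1, written as a nonnegative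
    variance that is scaled by \<open>n\<close> to stay integral.\<close>
  have "0 \<le> (\<Sum>x\<in>V - B. (n * F x - T)\<^sup>2)" by (simp add: sum_nonneg)
  also have "\<dots> = (\<Sum>x\<in>V - B. n\<^sup>2 * (F x)\<^sup>2 - 2 * n * T * F x + T\<^sup>2)"
    by (intro sum.cong refl) (simp add: power2_eq_square algebra_simps)
  also have "\<dots> = n\<^sup>2 * Q - 2 * n * T * T + n * T\<^sup>2"
    by (simp add: sum.distrib sum_subtractf T_def Q_def n_def flip: sum_distrib_left)
  also have "\<dots> = n * (n * Q - T\<^sup>2)"
    by (simp add: power2_eq_square algebra_simps)
  finally have "T\<^sup>2 \<le> n * Q" using n_pos by (simp add: zero_le_mult_iff)
  then have "(2 * int k - int l + int m)\<^sup>2 * a\<^sup>2 \<le> (v - b) * (4 * int m * a\<^sup>2 + D * a)"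
    by (simp add: T_def Q_def sum_F sum_F_sq n_eq power_mult_distrib)
  \<comment> \<open>In terms of r and s this is (2k - r - s)^2 = (r - s)^2 + 4 (k - r)(k - s); the
    parameter equation says that (k - r)(k - s) = m v.\<close>
  moreover have "(2 * int k - int l + int m)\<^sup>2 = D + 4 * int m * v"
  proof -
    have "int m * (v - 1 - int k) = int k * (int k - int l - 1)"
      using x0 A parameter_equation[of x0] by (auto simp: v_def)
    then show ?thesis by (simp add: D_def power2_eq_square algebra_simps)
  qed
  ultimately have "(D + 4 * int m * v) * a\<^sup>2 \<le> (v - b) * (4 * int m * a\<^sup>2 + D * a)"
    by simp
  then have "a * ((D + 4 * int m * v) * a) \<le> a * ((v - b) * (4 * int m * a + D))"
    by (simp add: power2_eq_square algebra_simps)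
  then have "(D + 4 * int m * v) * a \<le> (v - b) * (4 * int m * a + D)"
    using a_pos by simp
  \<comment> \<open>The term 4 m v a occurs on both sides and cancels.\<close>
  then have "4 * int m * a * b \<le> D * (v - a - b)" by (simp add: algebra_simps)
  moreover have "v - a - b = int (card (V - A - B))"
  proof -
    have "card (V - A - B) = card (V - (A \<union> B))" by (simp add: set_diff_eq)
    also have "int \<dots> = v - int (card (A \<union> B))"
      using A B finite_V by (simp add: v_def card_Diff_subset card_mono finite_subset)
    also have "int (card (A \<union> B)) = a + b"
      using A B finite_V disj by (simp add: a_def b_def card_Un_disjoint finite_subset)
    finally show ?thesis by simp
  qed
  ultimately show ?thesis by (simp add: a_def b_def D_def)
qed

end

section \<open>Arithmetic of the exceptional parameters\<close>

text \<open>In the application \<open>t\<close> counts the common neighbours of x, y and z, where z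
  is isolated by deleting the neighbourhood of the edge xy, and \<open>w\<close> counts the
  non-neighbours of a vertex. With d = m - l, the left side of \<open>hyp\<close> grows linearly in
  d and the right side at least quadratically, which confines d to 1 and 2.\<close>

lemma bad_edge_arithmetic:
  fixes k l m t w :: int
  assumes k: "k = 2 * m - t" and t: "t \<ge> 0" and m: "m < k" and l: "2 * l < k"
    and hyp: "4 * (k - 2 * l) * (k - m) > (l - m)\<^sup>2 * (2 * k - l - 3)"
    and count: "m * w = k * (k - l - 1)"
  shows "t = 0" "l < m" "m \<le> l + 2"
proof -
  define d where "d = m - l"
  have d: "t < 2 * d" and mt: "m - t > 0" using k m l t by (auto simp: d_def)
  have ineq: "4 * (2 * d - t) * (m - t) > d\<^sup>2 * (3 * m - 2 * t + d - 3)"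
  proof -
    have "k - 2 * l = 2 * d - t" "k - m = m - t" "(l - m)\<^sup>2 = d\<^sup>2"
      "2 * k - l - 3 = 3 * m - 2 * t + d - 3"
      using k by (auto simp: d_def power2_commute)
    then show ?thesis using hyp by metis
  qed
  have "d \<le> 2"
  proof (rule ccontr)
    assume "\<not> d \<le> 2"
    then have d3: "d \<ge> 3" by simp
    \<comment> \<open>The 9 is 3 times 3: one factor is absorbed by d \<ge> 3, the other is the
      coefficient of m in \<open>ineq\<close>.\<close>
    have "8 * (d * (m - t)) \<le> 9 * (d * (m - t))" using d3 mt by simp
    also have "\<dots> = 3 * d * (3 * (m - t))" by simp
    also have "\<dots> \<le> d\<^sup>2 * (3 * (m - t))"
      using d3 mt by (intro mult_right_mono) (auto simp: power2_eq_square)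
    also have "\<dots> \<le> d\<^sup>2 * (3 * m - 2 * t + d - 3)"
      using d3 t by (intro mult_left_mono) auto
    also have "\<dots> < 4 * (2 * d - t) * (m - t)" by (rule ineq)
    also have "\<dots> \<le> 8 * d * (m - t)" using t mt by (intro mult_right_mono) auto
    finally show False by simp
  qed
  then have d12: "d = 1 \<or> d = 2" using d t by auto
  then show "l < m" "m \<le> l + 2" by (auto simp: d_def)
  show "t = 0"
    using d12
  proof
    assume d1: "d = 1"
    \<comment> \<open>The inequality alone allows t = 1; by \<open>count\<close> m would then divide
      1, against m > t.\<close>
    have "t \<noteq> 1"
    proof
      assume "t = 1"
      then have "m * w = (2 * m - 1) * (m - 1)" using count k d1 by (simp add: d_def)
      then have "m * (w - 2 * m + 3) = 1" by (simp add: algebra_simps)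
      then have "m dvd 1" by (metis dvd_triv_left)
      then show False using mt \<open>t = 1\<close> by auto
    qed
    then show ?thesis using d d1 t by auto
  next
    assume d2: "d = 2"
    \<comment> \<open>Of the four values below 2 d, \<open>ineq\<close> together with m > t refutes
      1, 2 and 3.\<close>
    then have "t = 0 \<or> t = 1 \<or> t = 2 \<or> t = 3" using d t by auto
    then show ?thesis using ineq d2 mt by auto
  qed
qed

section \<open>Consequences of the hypothesis for the parameters\<close>

text \<open>Connectedness will be used in the form \<open>m_pos\<close>, and the existence of two
  separated vertices in the form \<open>noncomplete\<close>.\<close>

locale noncomplete_srg = srg +
  assumes V_ne: "V \<noteq> {}" and noncomplete: "k + 1 < card V" and m_pos: "0 < m"
    and hyp: "4 * (int k - 2 * int l) * (int k - int m)
      > (int l - int m)\<^sup>2 * (2 * int k - int l - 3)"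
begin

text \<open>The other side of the parameter equation is positive. The bound also keeps the truncated
  subtraction in \<open>2 * k - l - 2\<close> exact.\<close>

lemma l_less_k: "l + 2 \<le> k"
proof -
  obtain x where "x \<in> V" using V_ne by auto
  then have "int k * (int k - int l - 1) = int m * (int (card V) - 1 - int k)"
    by (simp add: parameter_equation)
  also have "\<dots> > 0" using noncomplete m_pos by simp
  finally show ?thesis by (simp add: zero_less_mult_iff)
qed

lemma m_le_k: "m \<le> k"
proof -
  obtain x where x: "x \<in> V" using V_ne by auto
  have "card (insert x (N x)) < card V"
    using x noncomplete adj_irrefl by (simp add: card_N mem_N_iff)
  then have "\<not> V \<subseteq> insert x (N x)" by (meson card_mono finite.insertI finite_N not_le)
  then obtain y where y: "y \<in> V" "y \<noteq> x" "\<not> adj x y" by (auto simp: mem_N_iff subset_iff)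
  then have "card (N x \<inter> N y) = m" using x card_common_nonadj by auto
  moreover have "card (N x \<inter> N y) \<le> card (N x)" by (intro card_mono) auto
  ultimately show ?thesis using x card_N by simp
qed

text \<open>The right side of \<open>hyp\<close> is nonnegative, so (k - 2l)(k - m) is positive, and
  \<open>m_le_k\<close> excludes two negative factors.\<close>

lemma two_l_less_k: "2 * l < k" and m_less_k: "m < k"
proof -
  have "0 \<le> (int l - int m)\<^sup>2 * (2 * int k - int l - 3)" using l_less_k by simp
  then have "0 < 4 * ((int k - 2 * int l) * (int k - int m))" using hyp by linarith
  then have "0 < (int k - 2 * int l) * (int k - int m)" by linarith
  then show "2 * l < k" "m < k" using m_le_k by (auto simp: zero_less_mult_iff)
qed

lemma card_edge_neighborhood:
  assumes "adj x y"
  shows "card (N x \<union> N y) = 2 * k - l"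
proof -
  have "x \<in> V" "y \<in> V" using assms adj_in_V adj_sym by blast+
  then have "card (N x \<union> N y) + card (N x \<inter> N y) = 2 * k"
    using card_Un_Int[of "N x" "N y"] by (simp add: card_N)
  then show ?thesis using assms by (simp add: card_common_adj)
qed

lemma card_edge_boundary:
  assumes "adj x y"
  shows "card (N x \<union> N y - {x, y}) = 2 * k - l - 2"
proof -
  have "{x, y} \<subseteq> N x \<union> N y" "x \<noteq> y"
    using assms adj_sym adj_irrefl by (auto simp: mem_N_iff)
  then show ?thesis by (simp add: card_Diff_subset card_edge_neighborhood[OF assms])
qed

section \<open>The lower bound for separators\<close>

text \<open>The separator is the remainder \<open>V - A - B\<close>. Of the condition on component
  sizes only one edge on each side is kept, which makes the notion symmetric and free of
  components.\<close>

definition separation :: "'a set \<Rightarrow> 'a set \<Rightarrow> bool" where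
  "separation A B \<longleftrightarrow> A \<subseteq> V \<and> B \<subseteq> V \<and> A \<inter> B = {} \<and> (\<forall>x\<in>A. \<forall>y\<in>B. \<not> adj x y) \<and>
     (\<exists>x\<in>A. \<exists>y\<in>A. adj x y) \<and> (\<exists>x\<in>B. \<exists>y\<in>B. adj x y)"

lemma separation_commute: "separation A B \<longleftrightarrow> separation B A"
  unfolding separation_def using adj_sym by blast

lemma separation_card_ge_2:
  assumes "separation A B"
  shows "2 \<le> card A"
proof -
  obtain x y where xy: "x \<in> A" "y \<in> A" "adj x y" using assms by (auto simp: separation_def)
  have "finite A" using assms finite_V by (auto simp: separation_def intro: finite_subset)
  then have "card {x, y} \<le> card A" using xy by (intro card_mono) auto
  then show ?thesis using xy adj_irrefl by (cases "x = y") auto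
qed

lemma separation_card_2:
  assumes sep: "separation A B" and small: "card A \<le> 2"
  shows "2 * k - l - 2 \<le> card (V - A - B)"
proof -
  obtain x y where xy: "x \<in> A" "y \<in> A" "adj x y" using sep by (auto simp: separation_def)
  have finA: "finite A" using sep finite_V by (auto simp: separation_def intro: finite_subset)
  have "x \<noteq> y" using xy adj_irrefl by auto
  then have "{x, y} = A" using finA xy small by (intro card_seteq) auto
  then have "N x \<union> N y - {x, y} \<subseteq> V - A - B"
    using sep xy N_subset by (auto simp: separation_def mem_N_iff adj_commute)
  then have "card (N x \<union> N y - {x, y}) \<le> card (V - A - B)"
    using finite_V by (intro card_mono) auto
  then show ?thesis using card_edge_boundary[OF xy(3)] by simp
qed

lemma card_separation:
  assumes "separation A B"
  shows "card A + card B + card (V - A - B) = card V"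
proof -
  have AB: "A \<subseteq> V" "B \<subseteq> V" "A \<inter> B = {}" using assms by (auto simp: separation_def)
  then have fin: "finite A" "finite B" using finite_V by (auto intro: finite_subset)
  have "V = A \<union> B \<union> (V - A - B)" using AB by auto
  also have "card \<dots> = card (A \<union> B) + card (V - A - B)"
    using fin finite_V by (intro card_Un_disjoint) auto
  also have "card (A \<union> B) = card A + card B" using AB fin by (intro card_Un_disjoint) auto
  finally show ?thesis by simp
qed

lemma separator_lower_bound:
  assumes sep: "separation A B"
  shows "2 * k - l - 2 \<le> card (V - A - B)"
proof (cases "card A \<le> 2 \<or> card B \<le> 2")
  case True
  then show ?thesis
  proof
    assume "card B \<le> 2"
    moreover have "V - B - A = V - A - B" by auto
    ultimately show ?thesis using sep separation_card_2[of B A] separation_commute by metis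
  qed (use sep separation_card_2 in blast)
next
  case False
  define a b s v where "a = int (card A)" and "b = int (card B)"
    and "s = int (card (V - A - B))" and "v = int (card V)"
  define K L M where "K = int k" and "L = int l" and "M = int m"
  have a: "a \<ge> 3" and b: "b \<ge> 3" using False by (auto simp: a_def b_def)
  have abs: "a + b = v - s"
    using card_separation[OF sep] by (simp add: a_def b_def s_def v_def)
  have M: "M > 0" "M < K" using m_pos m_less_k by (auto simp: M_def K_def)
  have bound: "4 * M * a * b \<le> ((L - M)\<^sup>2 + 4 * (K - M)) * s"
    using sep separation_bound[of A B] unfolding a_def b_def s_def K_def L_def M_def
    by (auto simp: separation_def)
  obtain x where "x \<in> V" using V_ne by auto
  then have eq: "M * (v - 1 - K) = K * (K - L - 1)"
    using parameter_equation by (simp add: M_def v_def K_def L_def)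
  have "2 * K - L - 2 \<le> s"
  proof (rule ccontr)
    \<comment> \<open>One less than the claimed bound, so a counterexample has s \<le> s'; it is
      also the last factor in \<open>hyp\<close>.\<close>
    define s' where "s' = 2 * K - L - 3"
    assume "\<not> 2 * K - L - 2 \<le> s"
    then have s: "s \<le> s'" by (simp add: s'_def)
    \<comment> \<open>Here v - s' - 3 = v - 2K + L is the number of vertices outside the
      neighbourhood of an edge.\<close>
    have "12 * ((K - M) * (K - L - 1)) = M * (12 * (v - s' - 3))"
      using eq by (simp add: s'_def algebra_simps)
    also have "\<dots> \<le> M * (4 * (a * b))"
    proof (intro mult_left_mono)
      \<comment> \<open>Both sides have at least three vertices, so for a given sum the product is
        smallest when one of them has exactly three.\<close>
      have "0 \<le> (a - 3) * (b - 3)" using a b by simp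
      then have "3 * (a + b) - 9 \<le> a * b" by (simp add: algebra_simps)
      then show "12 * (v - s' - 3) \<le> 4 * (a * b)" using s abs by simp
    qed (use M in simp)
    also have "\<dots> \<le> ((L - M)\<^sup>2 + 4 * (K - M)) * s" using bound by (simp add: algebra_simps)
    also have "\<dots> \<le> ((L - M)\<^sup>2 + 4 * (K - M)) * s'" using s M by (intro mult_left_mono) auto
    finally have "4 * (K - 2 * L) * (K - M) \<le> (L - M)\<^sup>2 * s'"
      by (simp add: s'_def algebra_simps)
    then show False using hyp by (simp add: s'_def K_def L_def M_def)
  qed
  then show ?thesis using l_less_k by (simp add: K_def L_def s_def)
qed

section \<open>Edges whose neighbourhood isolates a vertex\<close>

text \<open>Deleting the neighbourhood of the edge \<open>xy\<close>, except \<open>x\<close> and \<open>y\<close> themselves, isolates \<open>z\<close>.\<close>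

definition bad :: "'a \<Rightarrow> 'a \<Rightarrow> 'a \<Rightarrow> bool" where
  "bad x y z \<longleftrightarrow> adj x y \<and> z \<in> V \<and> z \<noteq> x \<and> z \<noteq> y \<and> \<not> adj x z \<and> \<not> adj y z \<and>
     N z \<subseteq> N x \<union> N y"

lemma badD:
  assumes "bad x y z"
  shows "adj x y" "x \<in> V" "y \<in> V" "z \<in> V" "N z \<subseteq> N x \<union> N y"
    "card (N x \<inter> N z) = m" "card (N y \<inter> N z) = m" "\<not> adj x z" "\<not> adj y z" "z \<noteq> x" "z \<noteq> y"
  using assms card_common_nonadj[of x z] card_common_nonadj[of y z] adj_in_V adj_sym
  unfolding bad_def by auto

text \<open>\<open>N z\<close> is covered by its intersections with \<open>N x\<close> and
  \<open>N y\<close>, of size m each, so k + t = 2m with t the size of the triple intersection;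
  \<open>bad_edge_arithmetic\<close> gives t = 0. Then card V - 1 - k = 2 (k - l - 1), which is at
  most k + 2 since m \<le> l + 2.\<close>

lemma bad_parameters:
  assumes "bad x y z"
  shows "N x \<inter> N y \<inter> N z = {}" "k = 2 * m" "l < m" "m \<le> l + 2" "card V \<le> 2 * k + 3"
proof -
  note b = badD[OF assms]
  define t where "t = card (N x \<inter> N y \<inter> N z)"
  have "N z = (N x \<inter> N z) \<union> (N y \<inter> N z)" using b by auto
  moreover have "(N x \<inter> N z) \<inter> (N y \<inter> N z) = N x \<inter> N y \<inter> N z" by auto
  ultimately have kt: "k + t = 2 * m"
    using b card_Un_Int[of "N x \<inter> N z" "N y \<inter> N z"] by (simp add: card_N t_def)
  define w where "w = int (card V) - 1 - int k"
  have count: "int m * w = int k * (int k - int l - 1)"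
    using b parameter_equation by (simp add: w_def)
  have "int t = 0" "int l < int m" "int m \<le> int l + 2"
    using bad_edge_arithmetic[of "int k" "int m" "int t" "int l" w]
      kt m_less_k two_l_less_k hyp count by auto
  then show "l < m" "m \<le> l + 2" and k: "k = 2 * m" and "N x \<inter> N y \<inter> N z = {}"
    using kt by (auto simp: t_def)
  have "int m * w = int m * (2 * (2 * int m - int l - 1))" using count k by simp
  then have "w = 2 * (2 * int m - int l - 1)" using m_pos by simp
  then show "card V \<le> 2 * k + 3" using k \<open>m \<le> l + 2\<close> by (simp add: w_def)
qed

lemma card_common_le:
  assumes "bad x y z" and "u \<in> V" "w \<in> V" "u \<noteq> w"
  shows "card (N u \<inter> N w) \<le> m"
  using assms bad_parameters(3)[OF assms(1)] card_common_adj card_common_nonadj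
  by (cases "adj u w") auto

text \<open>Both \<open>N y\<close> and \<open>N y'\<close> meet \<open>N z\<close> in exactly
  \<open>N z - N x\<close>. These m vertices together with \<open>x\<close> would be m + 1 common
  neighbours of \<open>y\<close> and \<open>y'\<close>.\<close>

lemma bad_unique:
  assumes "bad x y z" "bad x y' z"
  shows "y = y'"
proof (rule ccontr)
  assume "y \<noteq> y'"
  note b = badD[OF assms(1)] and b' = badD[OF assms(2)]
  have "N y \<inter> N z = N z - N x" "N y' \<inter> N z = N z - N x"
    using b b' bad_parameters(1)[OF assms(1)] bad_parameters(1)[OF assms(2)] by blast+
  then have "insert x (N y \<inter> N z) \<subseteq> N y \<inter> N y'"
    using b b' adj_sym by (auto simp: mem_N_iff)
  then have "card (insert x (N y \<inter> N z)) \<le> card (N y \<inter> N y')" by (intro card_mono) auto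
  moreover have "x \<notin> N z" using b by (simp add: mem_N_iff adj_commute)
  ultimately show False
    using b b' card_common_le[OF assms(1), of y y'] \<open>y \<noteq> y'\<close> by simp
qed

text \<open>The common neighbours of x, y and those of w, z form two disjoint sets of size l. Both
  lie in the common neighbourhood of the adjacent vertices w and y, so 2l \<le> l.\<close>

lemma bad_antisym:
  assumes xyz: "bad x y z" and zwx: "bad z w x"
  shows "l = 0"
proof -
  note b = badD[OF xyz] and b' = badD[OF zwx]
  note T = bad_parameters(1)[OF xyz] and T' = bad_parameters(1)[OF zwx]
  have "y \<in> N w" using b b' by (auto simp: mem_N_iff adj_commute)
  have sub: "(N x \<inter> N y) \<union> (N w \<inter> N z) \<subseteq> N w \<inter> N y" using T T' b b' by blast
  have "2 * l = card ((N x \<inter> N y) \<union> (N w \<inter> N z))"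
    using T b b' adj_sym by (subst card_Un_disjoint) (auto simp: card_common_adj)
  also have "\<dots> \<le> card (N w \<inter> N y)" using sub by (intro card_mono) auto
  also have "\<dots> = l" using \<open>y \<in> N w\<close> by (simp add: mem_N_iff card_common_adj)
  finally show ?thesis by simp
qed

text \<open>The m vertices of \<open>N y - N z\<close> turn out to have too many common neighbours
  with \<open>x\<close>, unless \<open>x\<close> is the only one of them.\<close>

lemma bad_triangle_free:
  assumes "bad x y z" and l: "l = 0"
  shows "m = 1"
proof -
  note b = badD[OF assms(1)] and k = bad_parameters(2)[OF assms(1)]
  have no_common: "N u \<inter> N w = {}" if "adj u w" for u w
    using card_common_adj[OF that] l by simp
  have x: "x \<in> N y" "x \<notin> N z" using b by (auto simp: mem_N_iff adj_commute)
  have card_yz: "card (N y - N z) = m"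
    using card_Diff_subset_Int[of "N y" "N z"] b k by (simp add: card_N)
  \<comment> \<open>Without triangles \<open>p\<close> is not adjacent to \<open>y\<close> and
    shares no neighbour with \<open>z\<close>; its m common neighbours with \<open>y\<close>
    therefore fill the m-element set \<open>N y - N z\<close>.\<close>
  have P: "N p \<inter> N y = N y - N z" if "p \<in> N x \<inter> N z" for p
  proof (rule card_seteq)
    show "N p \<inter> N y \<subseteq> N y - N z"
      using no_common[of p z] that by (auto simp: mem_N_iff adj_commute)
    have "p \<noteq> y" "\<not> adj p y" "p \<in> V"
      using that b no_common[of x y] adj_sym N_subset[of x] by (auto simp: mem_N_iff)
    then show "card (N y - N z) \<le> card (N p \<inter> N y)"
      using b card_yz by (simp add: card_common_nonadj)
  qed simp
  have "N y - N z \<subseteq> {x}"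
  proof
    fix u assume u: "u \<in> N y - N z"
    show "u \<in> {x}"
    proof (rule ccontr)
      assume "u \<notin> {x}"
      have "p \<in> N u" if "p \<in> N x \<inter> N z" for p
        using P[OF that] u by (auto simp: mem_N_iff adj_commute)
      \<comment> \<open>By \<open>P\<close>, \<open>u\<close> is adjacent to all of
        \<open>N x \<inter> N z\<close>; with \<open>y\<close> this makes m + 1 common neighbours of
        \<open>u\<close> and \<open>x\<close>.\<close>
      then have "insert y (N x \<inter> N z) \<subseteq> N u \<inter> N x"
        using u b by (auto simp: mem_N_iff adj_commute)
      then have "card (insert y (N x \<inter> N z)) \<le> card (N u \<inter> N x)" by (intro card_mono) auto
      moreover have "y \<notin> N z" using b by (simp add: mem_N_iff adj_commute)
      ultimately have "m < card (N u \<inter> N x)" using b by simp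
      moreover have "u \<in> V" using u N_subset by auto
      ultimately show False
        using card_common_le[OF assms(1), of u x] b \<open>u \<notin> {x}\<close> by simp
    qed
  qed
  then have "card (N y - N z) \<le> card {x}" by (intro card_mono) auto
  then show ?thesis using card_yz m_pos by simp
qed

text \<open>A bad edge \<open>(x, y)\<close> isolating \<open>z\<close> is determined by the nonadjacent pair \<open>(x, z)\<close>.  Unless
  \<open>l = 0\<close>, the pairs \<open>(x, z)\<close> and \<open>(z, x)\<close> do not both arise, but there are too few nonadjacent
  pairs for that.\<close>

lemma all_bad_parameters:
  assumes all_bad: "\<And>x y. adj x y \<Longrightarrow> \<exists>z. bad x y z"
  shows "k = 2" "l = 0" "m = 1"
proof -
  obtain x0 where x0: "x0 \<in> V" using V_ne by auto
  have "N x0 \<noteq> {}" using x0 card_N[of x0] l_less_k by auto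
  then obtain y0 where "adj x0 y0" by (auto simp: mem_N_iff)
  then obtain z0 where b0: "bad x0 y0 z0" using all_bad by blast
  note params = bad_parameters[OF b0]
  show l: "l = 0"
  proof (rule ccontr)
    assume l: "l \<noteq> 0"
    obtain f where f: "\<And>x y. adj x y \<Longrightarrow> bad x y (f x y)" using all_bad by metis
    define E where "E = (SIGMA x:V. N x)"
    define g where "g = (\<lambda>(x, y). (x, f x y))"
    define Z where "Z = (SIGMA x:V. V - insert x (N x))"
    have finE: "finite E" using finite_V by (auto simp: E_def)
    have finZ: "finite Z" using finite_V by (auto simp: Z_def)
    define J where "J = g ` E"
    have finJ: "finite J" using finE by (simp add: J_def)
    have "inj_on g E"
      using f bad_unique by (auto simp: inj_on_def g_def E_def mem_N_iff) metis
    then have "card J = card E" unfolding J_def by (rule card_image)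
    also have "\<dots> = card V * k" using finite_V by (simp add: E_def card_N)
    finally have card_J: "card J = card V * k" .
    have I: "\<exists>y. bad x y z" if xz: "(x, z) \<in> J" for x z
    proof -
      obtain y where "adj x y" "z = f x y"
        using xz by (auto simp: J_def g_def E_def mem_N_iff)
      then show ?thesis using f by blast
    qed
    have sub: "J \<union> J\<inverse> \<subseteq> Z"
    proof -
      have "(x, z) \<in> Z \<and> (z, x) \<in> Z" if xz: "(x, z) \<in> J" for x z
      proof -
        obtain y where "bad x y z" using I[OF xz] by blast
        from badD[OF this] show ?thesis using adj_sym by (auto simp: Z_def mem_N_iff)
      qed
      then show ?thesis by auto
    qed
    have "J \<inter> J\<inverse> = {}" using I bad_antisym l by blast
    then have "card (J \<union> J\<inverse>) = 2 * (card V * k)"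
      using finJ card_J by (subst card_Un_disjoint) auto
    then have "2 * (card V * k) \<le> card Z" using card_mono[OF finZ sub] by simp
    also have "\<dots> = (\<Sum>x\<in>V. card V - (k + 1))"
      unfolding Z_def using finite_V
      by (subst card_SigmaI)
         (auto intro!: sum.cong simp: card_Diff_subset N_subset card_N mem_N_iff adj_irrefl)
    also have "\<dots> = card V * (card V - (k + 1))" by simp
    finally have "card V * (2 * k) \<le> card V * (card V - (k + 1))" by (simp add: ac_simps)
    then have "2 * k \<le> card V - (k + 1)" using noncomplete by simp
    \<comment> \<open>With card V \<le> 2k + 3 this leaves k \<le> 2, while 0 < l < m makes k = 2m
      at least 4.\<close>
    then show False using params l noncomplete by linarith
  qed
  then show "m = 1" using b0 bad_triangle_free by blast
  then show "k = 2" using params by simp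
qed

section \<open>Existence of an edge whose neighbourhood separates nontrivially\<close>

text \<open>The parameter equation gives m times the number of these vertices as (k - l - 1)(k - m),
  which is positive.\<close>

lemma edge_nonneighbors_nonempty:
  assumes "adj x y"
  shows "V - (N x \<union> N y) \<noteq> {}"
proof -
  have "int (card (N x \<union> N y)) = 2 * int k - int l"
    using card_edge_neighborhood[OF assms] l_less_k by simp
  moreover have "int m * (int (card V) - (2 * int k - int l)) = (int k - int l - 1) * (int k - int m)"
    using parameter_equation[OF adj_in_V[OF assms]] by (simp add: algebra_simps)
  then have "0 < int m * (int (card V) - (2 * int k - int l))"
    using l_less_k m_less_k by simp
  then have "2 * int k - int l < int (card V)" using m_pos by (simp add: zero_less_mult_iff)
  ultimately have "card (N x \<union> N y) < card V" by simp
  then show ?thesis using card_mono[of "N x \<union> N y" V] by auto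
qed

lemma exists_good_edge:
  assumes sep: "separation A B"
  shows "\<exists>x y. adj x y \<and> (\<forall>z \<in> V - (N x \<union> N y). \<exists>w \<in> V - (N x \<union> N y). adj z w)"
proof -
  have "\<exists>x y. adj x y \<and> (\<forall>z. \<not> bad x y z)"
  proof (rule ccontr)
    assume "\<not> ?thesis"
    then have par: "k = 2" "l = 0" "m = 1" using all_bad_parameters by metis+
    obtain x where "x \<in> V" using V_ne by auto
    \<comment> \<open>Two sides and a separator of at least two vertices each would need
      six.\<close>
    then have "card V = 5" using parameter_equation[of x] par by simp
    then show False
      using separator_lower_bound[OF sep] card_separation[OF sep] par
        separation_card_ge_2[OF sep] separation_card_ge_2[of B A] sep separation_commute[of A B]
      by simp
  qed
  then obtain x y where xy: "adj x y" "\<And>z. \<not> bad x y z" by blast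
  have "\<exists>w \<in> V - (N x \<union> N y). adj z w" if z: "z \<in> V - (N x \<union> N y) - {x, y}" for z
  proof -
    have "\<not> N z \<subseteq> N x \<union> N y" using xy z by (auto simp: bad_def mem_N_iff)
    then show ?thesis using N_subset[of z] mem_N_iff by blast
  qed
  moreover have "x \<in> N y" "y \<in> N x" using xy adj_sym by (auto simp: mem_N_iff)
  ultimately show ?thesis using xy by blast
qed

end

section \<open>Degrees and components in the digraph representation\<close>

context graph
begin

text \<open>The out-degree counts arcs; without parallel arcs, arcs out of \<open>x\<close>
  correspond to neighbours of \<open>x\<close>.\<close>

lemma card_dominated:
  assumes "x \<in> verts G"
  shows "card {y \<in> verts G. x \<rightarrow>\<^bsub>G\<^esub> y} = out_degree G x"
proof -
  have "{y \<in> verts G. x \<rightarrow>\<^bsub>G\<^esub> y} = head G ` out_arcs G x"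
    by (auto simp: out_arcs_def arcs_ends_conv)
  moreover have "inj_on (head G) (out_arcs G x)"
    using no_multi_arcs by (auto simp: inj_on_def out_arcs_def arc_to_ends_def)
  ultimately show ?thesis by (simp add: out_degree_def card_image)
qed

lemma sym_digraph_del_verts: "sym_digraph (del_verts G S)"
  unfolding del_verts_def by (intro induced_graph_imp_graph induced_induce) auto

lemma verts_del_verts [simp]: "verts (del_verts G S) = verts G - S"
  by (simp add: del_verts_def)

lemma dominates_del_verts_iff:
  "x \<rightarrow>\<^bsub>del_verts G S\<^esub> y \<longleftrightarrow> x \<rightarrow>\<^bsub>G\<^esub> y \<and> x \<notin> S \<and> y \<notin> S"
  by (auto simp: del_verts_def arcs_ends_conv image_iff)

lemma connected_iff_reachable:
  "Digraph_Component.connected (del_verts G S) \<longleftrightarrow> verts G - S \<noteq> {} \<and>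
     (\<forall>x \<in> verts G - S. \<forall>y \<in> verts G - S. x \<rightarrow>\<^sup>*\<^bsub>del_verts G S\<^esub> y)"
proof -
  interpret H: sym_digraph "del_verts G S" by (rule sym_digraph_del_verts)
  show ?thesis
    unfolding Digraph_Component.connected_def strongly_connected_def
    using H.reachable_mk_symmetric_eq[OF H.sym_arcs] by simp
qed

lemma component_closed:
  assumes "x \<rightarrow>\<^sup>*\<^bsub>del_verts G S\<^esub> u" "u \<rightarrow>\<^bsub>G\<^esub> w" "w \<notin> S"
  shows "x \<rightarrow>\<^sup>*\<^bsub>del_verts G S\<^esub> w"
proof -
  interpret H: sym_digraph "del_verts G S" by (rule sym_digraph_del_verts)
  have "u \<notin> S" using H.reachable_in_verts(2)[OF assms(1)] by simp
  then have "u \<rightarrow>\<^bsub>del_verts G S\<^esub> w" using assms by (simp add: dominates_del_verts_iff)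
  with assms(1) show ?thesis by (rule H.reachable_adj_trans)
qed

text \<open>A component is a single vertex exactly when that vertex is isolated, so component sizes
  can be controlled through neighbours alone.\<close>

lemma two_le_card_sccs_iff:
  "(\<forall>C \<in> pre_digraph.sccs (del_verts G S). 2 \<le> card (verts C)) \<longleftrightarrow>
     (\<forall>x \<in> verts G - S. \<exists>y \<in> verts G - S. x \<rightarrow>\<^bsub>G\<^esub> y)"
proof -
  interpret H: sym_digraph "del_verts G S" by (rule sym_digraph_del_verts)
  have fin: "finite (verts G - S)" by simp
  show ?thesis
  proof (intro iffI ballI)
    fix x assume *: "\<forall>C \<in> H.sccs. 2 \<le> card (verts C)" and x: "x \<in> verts G - S"
    let ?C = "{y. x \<rightarrow>\<^sup>*\<^bsub>del_verts G S\<^esub> y}"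
    have "del_verts G S \<restriction> ?C \<in> H.sccs" using x by (intro H.induce_reachable_is_in_sccs) simp
    then have "2 \<le> card ?C" using * by fastforce
    then have "\<not> ?C \<subseteq> {x}" using card_mono[of "{x}" ?C] by auto
    then obtain y where "x \<rightarrow>\<^sup>*\<^bsub>del_verts G S\<^esub> y" "y \<noteq> x" by auto
    then obtain z where "x \<rightarrow>\<^bsub>del_verts G S\<^esub> z"
      by (blast elim: H.converse_reachable_cases[of x y])
    then show "\<exists>y \<in> verts G - S. x \<rightarrow>\<^bsub>G\<^esub> y"
      using H.adj_in_verts(2) dominates_del_verts_iff by auto
  next
    fix C assume *: "\<forall>x \<in> verts G - S. \<exists>y \<in> verts G - S. x \<rightarrow>\<^bsub>G\<^esub> y" and C: "C \<in> H.sccs"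
    have "verts C \<noteq> {}" using C by (auto simp: H.sccs_def strongly_connected_def)
    then obtain x where x: "x \<in> verts C" by auto
    have sub: "verts C \<subseteq> verts G - S"
      using C by (auto simp: H.sccs_def dest!: induced_imp_subgraph subgraph_imp_subverts)
    then obtain y where y: "y \<in> verts G - S" "x \<rightarrow>\<^bsub>G\<^esub> y" using * x by blast
    then have "x \<rightarrow>\<^bsub>del_verts G S\<^esub> y" using x sub dominates_del_verts_iff by auto
    then have "x \<rightarrow>\<^sup>*\<^bsub>del_verts G S\<^esub> y" by (rule H.reachable_adjI)
    let ?D = "del_verts G S \<restriction> {u. x \<rightarrow>\<^sup>*\<^bsub>del_verts G S\<^esub> u}"
    have xV: "x \<in> verts (del_verts G S)" using x sub by auto
    then have "?D \<in> H.sccs" by (rule H.induce_reachable_is_in_sccs)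
    moreover have "x \<in> verts C \<inter> verts ?D" using x H.reachable_refl[OF xV] by simp
    ultimately have "C = ?D" using H.scc_disj[OF C] by blast
    then have "y \<in> verts C" using \<open>x \<rightarrow>\<^sup>*\<^bsub>del_verts G S\<^esub> y\<close> by simp
    moreover have "x \<noteq> y" using y adj_not_same by auto
    moreover have "finite (verts C)" using sub fin by (rule finite_subset)
    ultimately show "2 \<le> card (verts C)"
      using x card_mono[of "verts C" "{x, y}"] by auto
  qed
qed

end

section \<open>Transfer to digraphs and computation of \<open>kappa2\<close>\<close>

lemma strongly_regular_imp_srg:
  assumes "strongly_regular G v k lam mu"
  shows "srg (verts G) (\<lambda>x y. x \<rightarrow>\<^bsub>G\<^esub> y) k lam mu"
proof -
  interpret graph G using assms by (simp add: strongly_regular_def)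
  have common: "{z \<in> verts G. x \<rightarrow>\<^bsub>G\<^esub> z} \<inter> {z \<in> verts G. y \<rightarrow>\<^bsub>G\<^esub> z}
      = common_neighbors G x y" for x y
    by (auto simp: common_neighbors_def)
  show ?thesis
  proof unfold_locales
    show "x \<rightarrow>\<^bsub>G\<^esub> y \<Longrightarrow> x \<in> verts G" for x y by (rule adj_in_verts)
    show "x \<rightarrow>\<^bsub>G\<^esub> y \<Longrightarrow> y \<rightarrow>\<^bsub>G\<^esub> x" for x y by (rule graph_symmetric)
    show "\<not> x \<rightarrow>\<^bsub>G\<^esub> x" for x using adj_not_same by blast
    show "x \<rightarrow>\<^bsub>G\<^esub> y \<Longrightarrow> card ({z \<in> verts G. x \<rightarrow>\<^bsub>G\<^esub> z} \<inter> {z \<in> verts G. y \<rightarrow>\<^bsub>G\<^esub> z}) = lam"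
      for x y
      using assms adj_in_verts unfolding common strongly_regular_def by blast
  qed (use assms in \<open>simp_all add: card_dominated common strongly_regular_def\<close>)
qed

text \<open>Otherwise being equal or adjacent to \<open>x\<close> would propagate along every walk
  from \<open>x\<close> and so reach \<open>y\<close>. This supplies the positivity of
  \<open>mu\<close>.\<close>

lemma noncomplete_connected_imp_common_neighbor:
  assumes "graph G" and conn: "Digraph_Component.connected G"
    and "x \<in> verts G" "y \<in> verts G" "x \<noteq> y" "\<not> x \<rightarrow>\<^bsub>G\<^esub> y"
  shows "\<exists>u \<in> verts G. \<exists>w \<in> verts G. u \<noteq> w \<and> \<not> u \<rightarrow>\<^bsub>G\<^esub> w \<and> common_neighbors G u w \<noteq> {}"
proof (rule ccontr)
  interpret graph G by fact
  assume contra: "\<not> ?thesis"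
  have triangle: "u = w \<or> u \<rightarrow>\<^bsub>G\<^esub> w" if "z \<rightarrow>\<^bsub>G\<^esub> u" "z \<rightarrow>\<^bsub>G\<^esub> w" for u w z
  proof -
    have "z \<in> common_neighbors G u w" "u \<in> verts G" "w \<in> verts G"
      using that adj_in_verts graph_symmetric by (auto simp: common_neighbors_def)
    then show ?thesis using contra by blast
  qed
  have "x \<rightarrow>\<^sup>*\<^bsub>G\<^esub> y"
    using conn assms(3,4) reachable_mk_symmetric_eq[OF sym_arcs]
    by (simp add: Digraph_Component.connected_def strongly_connected_def)
  then have "x = y \<or> x \<rightarrow>\<^bsub>G\<^esub> y"
    by (induction rule: reachable_induct) (use triangle graph_symmetric in blast)+
  then show False using assms by simp
qed

theorem proposition2p4:
  fixes G :: "('a, 'b) pre_digraph" and v k lam mu :: nat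
  assumes "strongly_regular G v k lam mu"
    and "Digraph_Component.connected G"
    and "4 * (int k - 2 * int lam) * (int k - int mu)
           > (int lam - int mu)\<^sup>2 * (2 * int k - int lam - 3)"
  shows "OK G k lam"
proof (cases "\<exists>S. nontrivially_disconnecting_set G S")
  case True
  interpret graph G using assms(1) by (simp add: strongly_regular_def)
  interpret srg "verts G" "\<lambda>x y. x \<rightarrow>\<^bsub>G\<^esub> y" k lam mu "\<lambda>x. {y \<in> verts G. x \<rightarrow>\<^bsub>G\<^esub> y}"
    using assms(1) by (simp add: strongly_regular_imp_srg)
  let ?N = "\<lambda>x. {y \<in> verts G. x \<rightarrow>\<^bsub>G\<^esub> y}"
  have separated: "\<exists>A B. A \<noteq> {} \<and> B \<noteq> {} \<and> A \<union> B = verts G - S \<and> A \<inter> B = {} \<and>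
      (\<forall>x\<in>A. \<forall>y\<in>B. \<not> x \<rightarrow>\<^bsub>G\<^esub> y) \<and> (\<exists>x\<in>A. \<exists>y\<in>A. x \<rightarrow>\<^bsub>G\<^esub> y) \<and> (\<exists>x\<in>B. \<exists>y\<in>B. x \<rightarrow>\<^bsub>G\<^esub> y)"
    if S: "nontrivially_disconnecting_set G S" for S
  proof -
    interpret H: sym_digraph "del_verts G S" by (rule sym_digraph_del_verts)
    obtain x y where xy: "x \<in> verts G - S" "y \<in> verts G - S" "\<not> x \<rightarrow>\<^sup>*\<^bsub>del_verts G S\<^esub> y"
      using S by (auto simp: nontrivially_disconnecting_set_def disconnecting_set_def
          connected_iff_reachable)
    \<comment> \<open>One side is the component of \<open>x\<close>, the other collects all
      remaining components.\<close>
    define A where "A = {u. x \<rightarrow>\<^sup>*\<^bsub>del_verts G S\<^esub> u}"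
    define B where "B = verts G - S - A"
    have A: "A \<subseteq> verts G - S" using H.reachable_in_verts(2) by (auto simp: A_def)
    have sep: "\<forall>u\<in>A. \<forall>w\<in>B. \<not> u \<rightarrow>\<^bsub>G\<^esub> w"
      using component_closed unfolding A_def B_def by blast
    have nbr: "\<exists>w \<in> verts G - S. u \<rightarrow>\<^bsub>G\<^esub> w" if "u \<in> verts G - S" for u
      using S that by (simp add: nontrivially_disconnecting_set_def two_le_card_sccs_iff)
    have xA: "x \<in> A" and yB: "y \<in> B" using xy by (auto simp: A_def B_def)
    obtain w where "w \<in> verts G - S" "x \<rightarrow>\<^bsub>G\<^esub> w" using nbr xy by blast
    then have "\<exists>x\<in>A. \<exists>y\<in>A. x \<rightarrow>\<^bsub>G\<^esub> y" using sep xA by (auto simp: B_def)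
    moreover obtain w where "w \<in> verts G - S" "y \<rightarrow>\<^bsub>G\<^esub> w" using nbr xy by blast
    then have "\<exists>x\<in>B. \<exists>y\<in>B. x \<rightarrow>\<^bsub>G\<^esub> y"
      using sep yB graph_symmetric unfolding B_def by blast
    ultimately show ?thesis using xA yB sep A by (intro exI[of _ A] exI[of _ B]) (auto simp: B_def)
  qed
  obtain S0 where S0: "nontrivially_disconnecting_set G S0" using True by blast
  obtain x y where xy: "x \<in> verts G" "y \<in> verts G" "x \<noteq> y" "\<not> x \<rightarrow>\<^bsub>G\<^esub> y"
    using separated[OF S0] by blast
  interpret noncomplete_srg "verts G" "\<lambda>x y. x \<rightarrow>\<^bsub>G\<^esub> y" k lam mu ?N
  proof unfold_locales
    have "card (insert y (insert x (?N x))) = k + 2"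
      using xy card_N[of x] adj_irrefl by simp
    moreover have "card (insert y (insert x (?N x))) \<le> card (verts G)"
      using xy by (intro card_mono) auto
    ultimately show "k + 1 < card (verts G)" by simp
    obtain u w where uw: "u \<in> verts G" "w \<in> verts G" "u \<noteq> w" "\<not> u \<rightarrow>\<^bsub>G\<^esub> w"
      "common_neighbors G u w \<noteq> {}"
      using noncomplete_connected_imp_common_neighbor[OF _ assms(2) xy] graph_axioms by blast
    moreover have "finite (common_neighbors G u w)" by (simp add: common_neighbors_def)
    moreover have "card (common_neighbors G u w) = mu"
      using assms(1) uw by (simp add: strongly_regular_def)
    ultimately show "0 < mu" by (auto simp: card_gt_0_iff)
    show "verts G \<noteq> {}" using xy by blast
  qed (rule assms(3))
  have lower: "2 * k - lam - 2 \<le> card S \<and> (\<exists>A B. separation A B)"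
    if S: "nontrivially_disconnecting_set G S" for S
  proof -
    obtain A B where AB: "A \<union> B = verts G - S" and disj: "A \<inter> B = {}"
      and no_arc: "\<forall>x\<in>A. \<forall>y\<in>B. \<not> x \<rightarrow>\<^bsub>G\<^esub> y"
      and arcs: "\<exists>x\<in>A. \<exists>y\<in>A. x \<rightarrow>\<^bsub>G\<^esub> y" "\<exists>x\<in>B. \<exists>y\<in>B. x \<rightarrow>\<^bsub>G\<^esub> y"
      using separated[OF S] by metis
    have "A \<subseteq> verts G" "B \<subseteq> verts G" using AB by blast+
    then have sep: "separation A B"
      unfolding separation_def using disj no_arc arcs by (intro conjI)
    have "S \<subseteq> verts G"
      using S by (simp add: nontrivially_disconnecting_set_def disconnecting_set_def)
    then have "verts G - A - B = S" using AB by blast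
    then show ?thesis using separator_lower_bound[OF sep] sep by auto
  qed
  obtain x y where edge: "x \<rightarrow>\<^bsub>G\<^esub> y"
    and good: "\<forall>z \<in> verts G - (?N x \<union> ?N y). \<exists>w \<in> verts G - (?N x \<union> ?N y). z \<rightarrow>\<^bsub>G\<^esub> w"
  proof -
    obtain A B where "separation A B" using lower[OF S0] by blast
    from exists_good_edge[OF this] show thesis using that by blast
  qed
  \<comment> \<open>The endpoints are kept, so that they form a component of their own.\<close>
  define S where "S = ?N x \<union> ?N y - {x, y}"
  have V: "x \<in> verts G" "y \<in> verts G" using adj_in_verts[OF edge] by auto
  have "nontrivially_disconnecting_set G S"
    unfolding nontrivially_disconnecting_set_def disconnecting_set_def two_le_card_sccs_iff
  proof (intro conjI ballI)
    interpret H: sym_digraph "del_verts G S" by (rule sym_digraph_del_verts)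
    show "S \<subseteq> verts G" "verts (del_verts G S) \<noteq> {}" using V by (auto simp: S_def)
    obtain z where z: "z \<in> verts G - (?N x \<union> ?N y)"
      using edge_nonneighbors_nonempty[OF edge] by blast
    show "\<not> Digraph_Component.connected (del_verts G S)"
    proof
      assume "Digraph_Component.connected (del_verts G S)"
      then have "x \<rightarrow>\<^sup>*\<^bsub>del_verts G S\<^esub> z"
        using V z by (auto simp: connected_iff_reachable S_def)
      \<comment> \<open>All other neighbours of \<open>x\<close> and \<open>y\<close> are deleted,
        so no walk leaves {x, y}.\<close>
      then have "z \<in> {x, y}"
      proof (induction rule: H.reachable_induct)
        case (step u w)
        then show ?case using adj_in_verts by (auto simp: dominates_del_verts_iff S_def)
      qed simp
      then show False using z edge V graph_symmetric by auto
    qed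
    fix u assume "u \<in> verts G - S"
    then consider "u = x" | "u = y" | "u \<in> verts G - (?N x \<union> ?N y)" by (auto simp: S_def)
    then show "\<exists>w \<in> verts G - S. u \<rightarrow>\<^bsub>G\<^esub> w"
    proof cases
      case 3
      then show ?thesis using good by (auto simp: S_def)
    qed (use V edge graph_symmetric in \<open>auto simp: S_def\<close>)
  qed
  moreover have "card S = 2 * k - lam - 2" unfolding S_def by (rule card_edge_boundary[OF edge])
  \<comment> \<open>\<open>S\<close> attains the bound that \<open>lower\<close> gives for every
    nontrivially disconnecting set.\<close>
  ultimately have "kappa2 G = 2 * k - lam - 2"
    unfolding kappa2_def using lower by (intro Least_equality) auto
  then show ?thesis using l_less_k by (simp add: OK_def)
qed (simp add: OK_def)

end
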